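(* Let $(X,G,\Phi)$ be a minimal equicontinuous action of a finitely generated infinite group $G$ on a Cantor set $X$, and let $x\in X$. Then there exists a collection of partitions $\{\mathcal{P}_i\}_{i\ge0}$ of $X$ such that the associated group chain $\{G_i\}_{i\ge0}$ with basepoint $x$ is in normal form.
   Context: $\Phi\colon G\times X\to X$ is an action by homeomorphisms; write $g\cdot x=\Phi(g)(x)$. The action is minimal if every orbit is dense, and equicontinuous (with respect to a metric $d$ on $X$) if for all $\varepsilon>0$ there is $\delta>0$ such that $d(u,v)<\delta$ implies $d(g\cdot u,g\cdot v)<\varepsilon$ for all $u,v\in X$, $g\in G$. A group chain in $G$ is a properly descending chain $G=G_0\supset G_1\supset G_2\supset\cdots$ of subgroups of finite index. A group chain associated to $(X,G,\Phi)$ with basepoint $x$ and partitions $\{\mathcal{P}_i\}_{i\ge0}$ is obtained from clopen sets $X=V_0\supset V_1\supset\cdots$ with $\bigcap_iV_i=\{x\}$ such that each $\mathcal{P}_i=\{g\cdot V_i\}_{g\in G}$ is a finite partition of $X$ and $\mathrm{diam}(g\cdot V_i)<2^{-i}$ for all $g\in G$, $i\ge1$, by setting $G_i=\{g\in G\mid g\cdot V_i=V_i\}$. With $C_i=\bigcap_{g\in G}gG_ig^{-1}$, the discriminant group at $x$ is $\mathcal{D}_x=\varprojlim\{G_{i+1}/C_{i+1}\to G_i/C_i\}$, with bonding maps induced by inclusion of cosets. The group chain $\{G_i\}_{i\ge0}$ is in normal form if the projections $\mathcal{D}_x\to G_i/C_i$ are onto for every $i\ge0$. *)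

theory Defs
  imports "HOL-Analysis.Analysis" "HOL-Algebra.Group_Action" "HOL-Algebra.Left_Coset"
    "HOL-Algebra.Product_Groups"
begin

subsection \<open>Cantor sets\<close>

definition totally_disconnected_space :: "'b topology \<Rightarrow> bool" where
  "totally_disconnected_space T \<longleftrightarrow> (\<forall>S. connectedin T S \<longrightarrow> (\<exists>a. S \<subseteq> {a}))"

definition perfect_space :: "'b topology \<Rightarrow> bool" where
  "perfect_space T \<longleftrightarrow> T derived_set_of topspace T = topspace T"

definition cantor_space :: "'b topology \<Rightarrow> bool" where
  "cantor_space T \<longleftrightarrow>
     topspace T \<noteq> {} \<and> compact_space T \<and> metrizable_space T \<and>
     totally_disconnected_space T \<and> perfect_space T"

text \<open>The library constant \<open>diameter\<close>, for an explicit metric instead of the class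
  \<open>metric_space\<close>. As there, the value is meaningful only for bounded sets; every subset of a
  compact metric space is bounded.\<close>

definition mdiameter :: "('b \<Rightarrow> 'b \<Rightarrow> real) \<Rightarrow> 'b set \<Rightarrow> real" where
  "mdiameter d S = (if S = {} then 0 else SUP (u, v) \<in> S \<times> S. d u v)"

subsection \<open>Group actions\<close>

definition finitely_generated_group :: "('a, 'm) monoid_scheme \<Rightarrow> bool" where
  "finitely_generated_group G \<longleftrightarrow>
     group G \<and> (\<exists>S. finite S \<and> S \<subseteq> carrier G \<and> generate G S = carrier G)"

text \<open>For \<open>group_action G (topspace T) \<phi>\<close> the maps \<open>\<phi> g\<close> are bijections of \<open>topspace T\<close>,
  extended by \<open>undefined\<close> outside of it.\<close>

definition action_by_homeomorphisms ::
    "('a, 'm) monoid_scheme \<Rightarrow> 'b topology \<Rightarrow> ('a \<Rightarrow> 'b \<Rightarrow> 'b) \<Rightarrow> bool" where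
  "action_by_homeomorphisms G T \<phi> \<longleftrightarrow>
     group_action G (topspace T) \<phi> \<and> (\<forall>g \<in> carrier G. homeomorphic_map T T (\<phi> g))"

definition minimal_action ::
    "('a, 'm) monoid_scheme \<Rightarrow> 'b topology \<Rightarrow> ('a \<Rightarrow> 'b \<Rightarrow> 'b) \<Rightarrow> bool" where
  "minimal_action G T \<phi> \<longleftrightarrow>
     (\<forall>y \<in> topspace T. T closure_of (orbit G \<phi> y) = topspace T)"

definition equicontinuous_action ::
    "('a, 'm) monoid_scheme \<Rightarrow> 'b set \<Rightarrow> ('b \<Rightarrow> 'b \<Rightarrow> real) \<Rightarrow> ('a \<Rightarrow> 'b \<Rightarrow> 'b) \<Rightarrow> bool" where
  "equicontinuous_action G X d \<phi> \<longleftrightarrow>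
     (\<forall>\<epsilon>>0. \<exists>\<delta>>0. \<forall>u \<in> X. \<forall>v \<in> X. \<forall>g \<in> carrier G. d u v < \<delta> \<longrightarrow> d (\<phi> g u) (\<phi> g v) < \<epsilon>)"

subsection \<open>Group chains\<close>

definition group_chain :: "('a, 'm) monoid_scheme \<Rightarrow> (nat \<Rightarrow> 'a set) \<Rightarrow> bool" where
  "group_chain G H \<longleftrightarrow>
     H 0 = carrier G \<and>
     (\<forall>i. subgroup (H i) G \<and> finite (lcosets\<^bsub>G\<^esub> (H i)) \<and> H (Suc i) \<subset> H i)"

text \<open>\<open>V\<close> is the sequence of clopen neighbourhoods of \<open>x\<close>; it is recovered from the partitions,
  \<open>V i\<close> being the member of \<open>P i\<close> that contains \<open>x\<close>.\<close>

definition chain_of_partitions ::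
    "('a, 'm) monoid_scheme \<Rightarrow> 'b set \<Rightarrow> ('b \<Rightarrow> 'b \<Rightarrow> real) \<Rightarrow> ('a \<Rightarrow> 'b \<Rightarrow> 'b) \<Rightarrow> 'b \<Rightarrow>
     (nat \<Rightarrow> 'b set) \<Rightarrow> (nat \<Rightarrow> 'b set set) \<Rightarrow> bool" where
  "chain_of_partitions G X d \<phi> x V P \<longleftrightarrow>
     V 0 = X \<and>
     (\<forall>i. V (Suc i) \<subseteq> V i) \<and>
     (\<forall>i. openin (Metric_space.mtopology X d) (V i) \<and>
          closedin (Metric_space.mtopology X d) (V i)) \<and>
     (\<Inter>i. V i) = {x} \<and>
     (\<forall>i. P i = {\<phi> g ` V i |g. g \<in> carrier G} \<and> finite (P i) \<and> partition_on X (P i)) \<and>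
     (\<forall>i\<ge>1. \<forall>g \<in> carrier G. mdiameter d (\<phi> g ` V i) < 1 / 2 ^ i)"

definition associated_chain ::
    "('a, 'm) monoid_scheme \<Rightarrow> ('a \<Rightarrow> 'b \<Rightarrow> 'b) \<Rightarrow> (nat \<Rightarrow> 'b set) \<Rightarrow> nat \<Rightarrow> 'a set" where
  "associated_chain G \<phi> V i = stabilizer G (\<lambda>g A. \<phi> g ` A) (V i)"

subsection \<open>The discriminant group\<close>

definition normal_core :: "('a, 'm) monoid_scheme \<Rightarrow> 'a set \<Rightarrow> 'a set" where
  "normal_core G H = (\<Inter>g \<in> carrier G. g <#\<^bsub>G\<^esub> H #>\<^bsub>G\<^esub> (inv\<^bsub>G\<^esub> g))"

definition core_quotient :: "('a, 'm) monoid_scheme \<Rightarrow> (nat \<Rightarrow> 'a set) \<Rightarrow> nat \<Rightarrow> 'a set monoid" where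
  "core_quotient G H i = (G\<lparr>carrier := H i\<rparr>) Mod (normal_core G (H i))"

text \<open>The map \<open>H (Suc i)/C (Suc i) \<rightarrow> H i/C i\<close>, where \<open>C i\<close> is the core of \<open>H i\<close>, sends a coset
  to the coset of \<open>C i\<close> that contains it.\<close>

definition bonding_map ::
    "('a, 'm) monoid_scheme \<Rightarrow> (nat \<Rightarrow> 'a set) \<Rightarrow> nat \<Rightarrow> 'a set \<Rightarrow> 'a set" where
  "bonding_map G H i A = (THE B. B \<in> carrier (core_quotient G H i) \<and> A \<subseteq> B)"

lemma (in group) normal_core_normal:
  assumes "subgroup H G"
  shows "normal_core G H \<lhd> G"
proof -
  have mem: "y \<in> normal_core G H \<longleftrightarrow> y \<in> carrier G \<and> (\<forall>g\<in>carrier G. inv g \<otimes> y \<otimes> g \<in> H)" for y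
  proof -
    have "y \<in> g <# H #> inv g \<longleftrightarrow> y \<in> carrier G \<and> inv g \<otimes> y \<otimes> g \<in> H" if g: "g \<in> carrier G" for g
    proof
      assume "y \<in> g <# H #> inv g"
      then obtain h where h: "h \<in> H" "y = g \<otimes> h \<otimes> inv g"
        by (auto simp: l_coset_def r_coset_def)
      then have "h \<in> carrier G" using assms subgroup.mem_carrier by metis
      with g h show "y \<in> carrier G \<and> inv g \<otimes> y \<otimes> g \<in> H"
        by (simp add: m_assoc) (simp add: m_assoc[symmetric])
    next
      assume y: "y \<in> carrier G \<and> inv g \<otimes> y \<otimes> g \<in> H"
      then have "y = g \<otimes> (inv g \<otimes> y \<otimes> g) \<otimes> inv g"
        using g by (simp add: m_assoc) (simp add: m_assoc[symmetric])
      with y show "y \<in> g <# H #> inv g"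
        unfolding l_coset_def r_coset_def by blast
    qed
    then show ?thesis
      unfolding normal_core_def by blast
  qed
  show ?thesis
  proof (rule normal_invI)
    show "subgroup (normal_core G H) G"
    proof (rule subgroupI)
      show "normal_core G H \<subseteq> carrier G" using mem by blast
      have "\<one> \<in> normal_core G H"
        using mem assms by (simp add: subgroup.one_closed)
      then show "normal_core G H \<noteq> {}" by blast
    next
      fix a assume a: "a \<in> normal_core G H"
      have "inv g \<otimes> inv a \<otimes> g = inv (inv g \<otimes> a \<otimes> g)" if "g \<in> carrier G" for g
        using that a mem by (simp add: inv_mult_group m_assoc)
      then show "inv a \<in> normal_core G H"
        using a mem assms by (simp add: subgroup.m_inv_closed)
    next
      fix a b assume a: "a \<in> normal_core G H" and b: "b \<in> normal_core G H"
      have "inv g \<otimes> (a \<otimes> b) \<otimes> g = (inv g \<otimes> a \<otimes> g) \<otimes> (inv g \<otimes> b \<otimes> g)" if g: "g \<in> carrier G" for g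
      proof -
        have "g \<otimes> (inv g \<otimes> (b \<otimes> g)) = b \<otimes> g"
          using g b mem by (simp add: m_assoc[symmetric])
        then show ?thesis using g a b mem by (simp add: m_assoc)
      qed
      then show "a \<otimes> b \<in> normal_core G H"
        using a b mem assms by (simp add: subgroup.m_closed)
    qed
  next
    fix k h assume k: "k \<in> carrier G" and h: "h \<in> normal_core G H"
    have "inv g \<otimes> (k \<otimes> h \<otimes> inv k) \<otimes> g = inv (inv k \<otimes> g) \<otimes> h \<otimes> (inv k \<otimes> g)" if "g \<in> carrier G" for g
      using that k h mem by (simp add: inv_mult_group m_assoc)
    then show "k \<otimes> h \<otimes> inv k \<in> normal_core G H"
      using k h mem by simp
  qed
qed

lemma bonding_map_coset:
  assumes G: "group G" and H: "group_chain G H" and g: "g \<in> H (Suc i)"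
  shows "bonding_map G H i (normal_core G (H (Suc i)) #>\<^bsub>G\<^esub> g) = normal_core G (H i) #>\<^bsub>G\<^esub> g"
proof -
  interpret group G by fact
  let ?C = "normal_core G (H i)" and ?C' = "normal_core G (H (Suc i))"
  have sub: "subgroup (H i) G" "subgroup (H (Suc i)) G" "H (Suc i) \<subseteq> H i"
    using H unfolding group_chain_def by blast+
  have C: "subgroup ?C G" "subgroup ?C' G"
    by (intro normal_imp_subgroup normal_core_normal sub)+
  have le: "?C' \<subseteq> ?C"
    using sub(3) unfolding normal_core_def l_coset_def r_coset_def
    by (intro INF_mono' UN_mono) auto
  have gi: "g \<in> H i" "g \<in> carrier G"
    using sub(3) g subgroup.subset[OF sub(2)] by auto
  have car: "carrier (core_quotient G H i) = {?C #>\<^bsub>G\<^esub> a |a. a \<in> H i}"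
    by (auto simp: core_quotient_def FactGroup_def RCOSETS_def r_coset_def)
  have "g \<in> ?C' #>\<^bsub>G\<^esub> g"
    using C(2) gi(2) by (rule rcos_self[rotated])
  moreover have "?C #>\<^bsub>G\<^esub> a = ?C #>\<^bsub>G\<^esub> g" if "g \<in> ?C #>\<^bsub>G\<^esub> a" "a \<in> H i" for a
    using repr_independence[OF that(1) _ C(1)] that(2) subgroup.subset[OF sub(1)] by auto
  moreover have "?C' #>\<^bsub>G\<^esub> g \<subseteq> ?C #>\<^bsub>G\<^esub> g"
    using le unfolding r_coset_def by blast
  ultimately show ?thesis
    unfolding bonding_map_def car using gi(1) by (intro the_equality) blast+
qed

text \<open>The inverse limit of groups, as a subgroup of the product.\<close>

definition discriminant_group ::
    "('a, 'm) monoid_scheme \<Rightarrow> (nat \<Rightarrow> 'a set) \<Rightarrow> (nat \<Rightarrow> 'a set) monoid" where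
  "discriminant_group G H =
     (product_group UNIV (core_quotient G H))
       \<lparr>carrier := {s \<in> carrier (product_group UNIV (core_quotient G H)).
                     \<forall>i. bonding_map G H i (s (Suc i)) = s i}\<rparr>"

definition normal_form :: "('a, 'm) monoid_scheme \<Rightarrow> (nat \<Rightarrow> 'a set) \<Rightarrow> bool" where
  "normal_form G H \<longleftrightarrow>
     (\<forall>i. (\<lambda>s. s i) ` carrier (discriminant_group G H) = carrier (core_quotient G H i))"

end

theory Submission
  imports Defs
begin

text \<open>For a normal subgroup \<open>N\<close> of finite index, equicontinuity makes ``\<open>y\<close> lies in the closure of
  \<open>N \<cdot> z\<close>'' a \<open>G\<close>-invariant equivalence relation on \<open>X\<close>; by minimality it has finitely many
  classes, which are therefore clopen. Let \<open>N\<^sub>0 \<supseteq> N\<^sub>1 \<supseteq> \<dots>\<close> be such subgroups with \<open>N\<^sub>0 = G\<close>, let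
  \<open>V\<^sub>i\<close> be the closure of \<open>N\<^sub>i \<cdot> x\<close>, and let \<open>G\<^sub>i = {g. g \<cdot> x \<in> V\<^sub>i}\<close> be its stabilizer. Then
  \<open>N\<^sub>i\<close> is contained in the core \<open>C\<^sub>i\<close>. If \<open>g \<in> G\<^sub>i\<close> then \<open>x\<close> lies in the closure of
  \<open>N\<^sub>i \<cdot> (g \<cdot> x)\<close>, and \<open>V\<^sub>i\<^sub>+\<^sub>1\<close> is a neighbourhood of \<open>x\<close>, so \<open>n \<cdot> g \<cdot> x \<in> V\<^sub>i\<^sub>+\<^sub>1\<close> for some \<open>n \<in> N\<^sub>i\<close>.
  Hence \<open>G\<^sub>i\<^sub>+\<^sub>1\<close> meets every coset of \<open>C\<^sub>i\<close> in \<open>G\<^sub>i\<close>: the bonding maps are onto.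

  To make the translates of \<open>V\<^sub>i\<close> small, take for \<open>N\<^sub>i\<close> the kernel of the action of \<open>G\<close> on the
  itineraries of points with respect to a fine finite clopen cover. By equicontinuity nearby points
  have equal itineraries, so there are finitely many of them and the kernel has finite index.\<close>

section \<open>Normal cores and threads in the inverse limit\<close>

text \<open>Conjugation by \<open>inv g\<close> keeps \<open>n\<close> in \<open>N\<close>, hence in
  \<open>H\<close>, so \<open>n\<close> lies in every conjugate of \<open>H\<close>. This gives a
  lower bound for the cores without computing them.\<close>

lemma (in group) normal_subset_normal_core:
  assumes N: "N \<lhd> G" and "N \<subseteq> H"
  shows "N \<subseteq> normal_core G H"
proof
  fix n assume n: "n \<in> N"
  have nG: "n \<in> carrier G"
    using n N normal_imp_subgroup subgroup.mem_carrier by metis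
  show "n \<in> normal_core G H"
    unfolding normal_core_def
  proof
    fix g assume g: "g \<in> carrier G"
    have "inv g \<otimes> n \<otimes> g \<in> H"
      using normal.inv_op_closed1[OF N g n] assms(2) by blast
    moreover have "n = g \<otimes> (inv g \<otimes> n \<otimes> g) \<otimes> inv g"
      using g nG by (simp add: m_assoc) (simp add: m_assoc[symmetric])
    ultimately show "n \<in> g <# H #> inv g"
      unfolding l_coset_def r_coset_def by blast
  qed
qed

text \<open>Every projection is onto as soon as every bonding map is: the partial thread through a given
  coset extends upwards one step at a time, and downwards by the inclusions.\<close>

lemma normal_form_stepI:
  fixes G (structure)
  assumes "group G" and H: "group_chain G H"
    and step: "\<And>i g. g \<in> H i \<Longrightarrow> \<exists>n\<in>normal_core G (H i). n \<otimes> g \<in> H (Suc i)"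
  shows "normal_form G H"
  unfolding normal_form_def
proof
  fix i
  interpret group G by fact
  let ?C = "\<lambda>j. normal_core G (H j)"
  have sub: "subgroup (H j) G" for j
    using H unfolding group_chain_def by blast
  have HG: "H j \<subseteq> carrier G" for j
    using sub subgroup.subset by blast
  have C: "subgroup (?C j) G" for j
    by (intro normal_imp_subgroup normal_core_normal sub)
  have dec: "H (Suc j) \<subseteq> H j" for j
    using H unfolding group_chain_def by blast
  have car: "carrier (core_quotient G H j) = {?C j #> a |a. a \<in> H j}" for j
    by (auto simp: core_quotient_def FactGroup_def RCOSETS_def r_coset_def)
  have carD: "carrier (discriminant_group G H) =
      {s. (\<forall>j. s j \<in> carrier (core_quotient G H j)) \<and> (\<forall>j. bonding_map G H j (s (Suc j)) = s j)}"
    by (auto simp: discriminant_group_def)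
  show "(\<lambda>s. s i) ` carrier (discriminant_group G H) = carrier (core_quotient G H i)"
  proof
    show "(\<lambda>s. s i) ` carrier (discriminant_group G H) \<subseteq> carrier (core_quotient G H i)"
      by (auto simp: carD)
    show "carrier (core_quotient G H i) \<subseteq> (\<lambda>s. s i) ` carrier (discriminant_group G H)"
    proof
      fix A assume "A \<in> carrier (core_quotient G H i)"
      then obtain g where g: "g \<in> H i" and A: "A = ?C i #> g"
        by (auto simp: car)
      have low: "g \<in> H j" if "j \<le> i" for j
        using g lift_Suc_antimono_le[of H, OF dec that] by blast
      obtain a where a: "\<And>j. a j \<in> H j" "\<And>j. j \<le> i \<Longrightarrow> a j = g"
        and a_Suc: "\<And>j. \<exists>n\<in>?C j. a (Suc j) = n \<otimes> a j"
      proof -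
        \<comment> \<open>Representatives are chosen instead of cosets. Up to \<open>i\<close> they
          are frozen at \<open>g\<close>, so that the thread passes through \<open>A\<close>; beyond
          \<open>i\<close> each is corrected on the left by an element of \<open>?C j\<close>, which
          leaves its coset at level \<open>j\<close> unchanged.\<close>
        have "\<exists>a. \<forall>j. (a j \<in> H j \<and> (j \<le> i \<longrightarrow> a j = g)) \<and> (\<exists>n\<in>?C j. a (Suc j) = n \<otimes> a j)"
        proof (rule dependent_nat_choice)
          show "\<exists>a. a \<in> H 0 \<and> (0 \<le> i \<longrightarrow> a = g)"
            using low by auto
        next
          fix b j assume b: "b \<in> H j \<and> (j \<le> i \<longrightarrow> b = g)"
          show "\<exists>c. (c \<in> H (Suc j) \<and> (Suc j \<le> i \<longrightarrow> c = g)) \<and> (\<exists>n\<in>?C j. c = n \<otimes> b)"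
          proof (cases "Suc j \<le> i")
            case True
            then have "b = g" "g = \<one> \<otimes> g" "\<one> \<in> ?C j"
              using b g HG[of i] subgroup.one_closed[OF C] by auto
            then show ?thesis
              using low[OF True] by blast
          next
            case False
            then show ?thesis
              using step[of b j] b by blast
          qed
        qed
        then show ?thesis
          using that by blast
      qed
      have "bonding_map G H j (?C (Suc j) #> a (Suc j)) = ?C j #> a j" for j
      proof -
        obtain n where n: "n \<in> ?C j" "a (Suc j) = n \<otimes> a j"
          using a_Suc by blast
        have in_G: "n \<in> carrier G" "a j \<in> carrier G"
          using n(1) a(1) subgroup.mem_carrier[OF C] subgroup.mem_carrier[OF sub] by blast+
        have "bonding_map G H j (?C (Suc j) #> a (Suc j)) = ?C j #> a (Suc j)"
          by (rule bonding_map_coset[OF \<open>group G\<close> H a(1)])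
        also have "\<dots> = ?C j #> n #> a j"
          using n(2) in_G coset_mult_assoc[OF subgroup.subset[OF C]] by simp
        also have "\<dots> = ?C j #> a j"
          by (simp only: subgroup.rcos_const[OF C \<open>group G\<close> n(1)])
        finally show ?thesis .
      qed
      then have "(\<lambda>j. ?C j #> a j) \<in> carrier (discriminant_group G H)"
        using a(1) by (auto simp: carD car)
      then show "A \<in> (\<lambda>s. s i) ` carrier (discriminant_group G H)"
        by (rule rev_image_eqI) (simp add: A a(2))
    qed
  qed
qed

section \<open>Clopen sets in compact metric spaces\<close>

text \<open>A Lebesgue number of the open cover by \<open>U\<close> and its complement works: no
  ball of that radius meets both sides.\<close>

lemma (in Metric_space) clopen_uniform:
  assumes "compact_space mtopology" and "openin mtopology U" and "closedin mtopology U"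
  shows "\<exists>\<delta>>0. \<forall>u\<in>M. \<forall>v\<in>M. d u v < \<delta> \<longrightarrow> (u \<in> U \<longleftrightarrow> v \<in> U)"
proof -
  have "\<exists>\<delta>>0. \<forall>u\<in>M. \<exists>W\<in>{U, M - U}. mball u \<delta> \<subseteq> W"
  proof (rule lebesgue_number)
    show "compactin mtopology M"
      using assms(1) by (simp add: compact_space_def)
  qed (use assms in \<open>auto simp: closedin_def\<close>)
  then obtain \<delta> where \<delta>: "\<delta> > 0" "\<And>u. u \<in> M \<Longrightarrow> \<exists>W\<in>{U, M - U}. mball u \<delta> \<subseteq> W"
    by blast
  have "u \<in> U \<longleftrightarrow> v \<in> U" if "u \<in> M" "v \<in> M" "d u v < \<delta>" for u v
  proof -
    have "u \<in> mball u \<delta>" "v \<in> mball u \<delta>"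
      using that \<delta>(1) by auto
    then show ?thesis
      using \<delta>(2)[OF that(1)] by blast
  qed
  then show ?thesis
    using \<delta>(1) by blast
qed

text \<open>Connected sets have at most one point, so none joins \<open>a\<close> to the complement
  of a small ball around it. The cut-wire fence theorem then gives a clopen neighbourhood of
  \<open>a\<close> inside the ball, and compactness leaves finitely many of these.\<close>

lemma (in Metric_space) small_clopen_cover:
  assumes comp: "compact_space mtopology" and td: "totally_disconnected_space mtopology"
    and "\<epsilon> > 0"
  shows "\<exists>\<U>. finite \<U> \<and> (\<forall>U\<in>\<U>. openin mtopology U \<and> closedin mtopology U) \<and> \<Union>\<U> = M \<and>
           (\<forall>U\<in>\<U>. \<forall>u\<in>U. \<forall>v\<in>U. d u v < \<epsilon>)"
proof -
  define \<C> where "\<C> = {U. openin mtopology U \<and> closedin mtopology U \<and> (\<forall>u\<in>U. \<forall>v\<in>U. d u v < \<epsilon>)}"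
  have "\<exists>U\<in>\<C>. a \<in> U" if a: "a \<in> M" for a
  proof -
    have "separated_between mtopology {a} (M - mball a (\<epsilon>/2))"
    proof (rule cut_wire_fence_theorem)
      show "closedin mtopology {a}"
        using a by (simp add: Hausdorff_space_mtopology closedin_Hausdorff_singleton)
      show "closedin mtopology (M - mball a (\<epsilon>/2))"
        by (metis closedin_diff closedin_topspace openin_mball topspace_mtopology)
    next
      fix C assume "connectedin mtopology C"
      then obtain c where "C \<subseteq> {c}"
        using td unfolding totally_disconnected_space_def by blast
      moreover have "a \<in> mball a (\<epsilon>/2)"
        using a \<open>\<epsilon> > 0\<close> by simp
      ultimately show "disjnt C {a} \<or> disjnt C (M - mball a (\<epsilon>/2))"
        unfolding disjnt_def by blast
    qed (use comp Hausdorff_space_mtopology in auto)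
    then obtain U where U: "closedin mtopology U" "openin mtopology U" "a \<in> U"
        and "M - mball a (\<epsilon>/2) \<subseteq> M - U"
      unfolding separated_between by auto
    moreover have "U \<subseteq> M"
      using U openin_subset by fastforce
    ultimately have sub: "U \<subseteq> mball a (\<epsilon>/2)"
      by blast
    have "d u v < \<epsilon>" if "u \<in> U" "v \<in> U" for u v
    proof -
      have "u \<in> mball a (\<epsilon>/2)" "v \<in> mball a (\<epsilon>/2)"
        using that sub by auto
      then have "d u v \<le> d a u + d a v" "d a u < \<epsilon>/2" "d a v < \<epsilon>/2"
        using triangle'' by auto
      then show ?thesis by linarith
    qed
    then show ?thesis
      using U unfolding \<C>_def by blast
  qed
  then have "\<Union>\<C> = topspace mtopology"
    unfolding \<C>_def using openin_subset by fastforce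
  moreover have "\<forall>U\<in>\<C>. openin mtopology U"
    unfolding \<C>_def by blast
  ultimately obtain \<U> where "finite \<U>" "\<U> \<subseteq> \<C>" "\<Union>\<U> = M"
    using comp unfolding compact_space by (metis topspace_mtopology)
  then show ?thesis
    unfolding \<C>_def by (intro exI[of _ \<U>]) blast
qed

text \<open>On \<open>A\<close> the map \<open>k\<close> factors through \<open>f\<close>. This
  serves to count cosets by finite invariants.\<close>

lemma finite_image_coarser:
  assumes "finite (f ` A)" and "\<And>a b. a \<in> A \<Longrightarrow> b \<in> A \<Longrightarrow> f a = f b \<Longrightarrow> k a = k b"
  shows "finite (k ` A)"
proof -
  have "k a = k (inv_into A f (f a))" if "a \<in> A" for a
    using that by (intro assms(2)) (auto simp: inv_into_into f_inv_into_f)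
  then have "k ` A \<subseteq> (\<lambda>b. k (inv_into A f b)) ` f ` A"
    by blast
  then show ?thesis
    using assms(1) finite_subset by blast
qed

section \<open>Equicontinuous actions on compact metric spaces\<close>

locale equicontinuous_system = group_action G X \<phi> + Metric_space X d
  for G :: "('a, 'm) monoid_scheme" (structure) and X :: "'b set" and \<phi> and d +
  assumes compact: "compact_space mtopology"
    and equicontinuous: "equicontinuous_action G X d \<phi>"
begin

sublocale group G
  using group_hom group_hom.axioms(1) by auto

lemma act_closed: "g \<in> carrier G \<Longrightarrow> u \<in> X \<Longrightarrow> \<phi> g u \<in> X"
  using element_image by blast

lemma act_one: "u \<in> X \<Longrightarrow> \<phi> \<one> u = u"
  using id_eq_one by (metis restrict_apply')

lemma act_inv: "g \<in> carrier G \<Longrightarrow> u \<in> X \<Longrightarrow> \<phi> (inv g) (\<phi> g u) = u"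
  using orbit_sym_aux by blast

lemma act_inv': "g \<in> carrier G \<Longrightarrow> u \<in> X \<Longrightarrow> \<phi> g (\<phi> (inv g) u) = u"
  using act_inv[of "inv g" u] by simp

subsection \<open>Kernels of finite clopen codings\<close>

text \<open>A relation rather than a function of \<open>h\<close>, because the members of
  \<open>\<U>\<close> may overlap or miss points.\<close>

definition itinerary :: "'b set set \<Rightarrow> 'b \<Rightarrow> ('a \<times> 'b set) set" where
  "itinerary \<U> u = {(h, U). h \<in> carrier G \<and> U \<in> \<U> \<and> \<phi> h u \<in> U}"

definition itinerary_kernel :: "'b set set \<Rightarrow> 'a set" where
  "itinerary_kernel \<U> = {g \<in> carrier G. \<forall>u\<in>X. itinerary \<U> (\<phi> g u) = itinerary \<U> u}"

definition clopen_family :: "'b set set \<Rightarrow> bool" where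
  "clopen_family \<U> \<longleftrightarrow> finite \<U> \<and> (\<forall>U\<in>\<U>. openin mtopology U \<and> closedin mtopology U)"

text \<open>The itinerary of \<open>\<phi> g w\<close> is that of \<open>w\<close> shifted by right
  multiplication with \<open>g\<close>. Hence the group acts on itineraries, and
  \<open>itinerary_kernel\<close> is the kernel of that action.\<close>

lemma itinerary_act:
  assumes "g \<in> carrier G" "u \<in> X" "v \<in> X" "itinerary \<U> u = itinerary \<U> v"
  shows "itinerary \<U> (\<phi> g u) = itinerary \<U> (\<phi> g v)"
proof -
  have "(h, U) \<in> itinerary \<U> (\<phi> g w) \<longleftrightarrow> h \<in> carrier G \<and> (h \<otimes> g, U) \<in> itinerary \<U> w"
    if "w \<in> X" for h U w
    using that assms(1) by (auto simp: itinerary_def composition_rule)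
  then show ?thesis
    using assms by auto
qed

lemma itinerary_kernel_mono: "\<U> \<subseteq> \<W> \<Longrightarrow> itinerary_kernel \<W> \<subseteq> itinerary_kernel \<U>"
  unfolding itinerary_kernel_def itinerary_def by blast

lemma itinerary_kernel_empty: "itinerary_kernel {} = carrier G"
  by (simp add: itinerary_kernel_def itinerary_def)

lemma itinerary_kernel_normal: "itinerary_kernel \<U> \<lhd> G"
proof (rule normal_invI)
  show "subgroup (itinerary_kernel \<U>) G"
  proof (rule subgroupI)
    show "itinerary_kernel \<U> \<subseteq> carrier G"
      by (auto simp: itinerary_kernel_def)
    have "\<one> \<in> itinerary_kernel \<U>"
      by (simp add: itinerary_kernel_def act_one)
    then show "itinerary_kernel \<U> \<noteq> {}" by blast
  next
    fix a assume a: "a \<in> itinerary_kernel \<U>"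
    then have "itinerary \<U> (\<phi> (inv a) u) = itinerary \<U> u" if "u \<in> X" for u
      using that act_closed[of "inv a" u] act_inv'[of a u]
      unfolding itinerary_kernel_def by force
    then show "inv a \<in> itinerary_kernel \<U>"
      using a by (simp add: itinerary_kernel_def)
  next
    fix a b assume "a \<in> itinerary_kernel \<U>" "b \<in> itinerary_kernel \<U>"
    then show "a \<otimes> b \<in> itinerary_kernel \<U>"
      by (simp add: itinerary_kernel_def composition_rule act_closed)
  qed
next
  fix k h assume k: "k \<in> carrier G" and h: "h \<in> itinerary_kernel \<U>"
  then have hG: "h \<in> carrier G"
    by (simp add: itinerary_kernel_def)
  have "itinerary \<U> (\<phi> (k \<otimes> h \<otimes> inv k) u) = itinerary \<U> u" if u: "u \<in> X" for u
  proof -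
    let ?v = "\<phi> (inv k) u"
    have v: "?v \<in> X"
      using u k act_closed by simp
    \<comment> \<open>\<open>h\<close> fixes the itinerary of \<open>?v\<close>, and
      \<open>k\<close> carries equal itineraries to equal ones; \<open>\<phi> k ?v\<close> is
      \<open>u\<close>.\<close>
    have "itinerary \<U> (\<phi> k (\<phi> h ?v)) = itinerary \<U> (\<phi> k ?v)"
      using h v k hG by (intro itinerary_act) (auto simp: itinerary_kernel_def act_closed)
    then show ?thesis
      using u v k hG by (simp add: composition_rule act_inv')
  qed
  then show "k \<otimes> h \<otimes> inv k \<in> itinerary_kernel \<U>"
    using k hG by (simp add: itinerary_kernel_def)
qed

text \<open>Membership in the sets of \<open>\<U>\<close> is constant at scale
  \<open>\<epsilon>\<close>, and equicontinuity gives one \<open>\<delta>\<close> that keeps all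
  translates of two points \<open>\<epsilon>\<close>-close. Points at distance below
  \<open>\<delta>\<close> thus share their itinerary, and a finite \<open>\<delta>\<close>-net
  realizes all of them.\<close>

lemma finite_itineraries:
  assumes "clopen_family \<U>"
  shows "finite (itinerary \<U> ` X)"
proof -
  have "\<exists>\<delta>>0. \<forall>U\<in>\<U>. \<forall>u\<in>X. \<forall>v\<in>X. d u v < \<delta> \<longrightarrow> (u \<in> U \<longleftrightarrow> v \<in> U)"
  proof -
    have "\<forall>U\<in>\<U>. \<exists>\<delta>>0. \<forall>u\<in>X. \<forall>v\<in>X. d u v < \<delta> \<longrightarrow> (u \<in> U \<longleftrightarrow> v \<in> U)"
      using assms clopen_uniform[OF compact] unfolding clopen_family_def by blast
    then obtain \<delta> where \<delta>: "\<And>U. U \<in> \<U> \<Longrightarrow> \<delta> U > 0"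
      "\<And>U u v. U \<in> \<U> \<Longrightarrow> u \<in> X \<Longrightarrow> v \<in> X \<Longrightarrow> d u v < \<delta> U \<Longrightarrow> u \<in> U \<longleftrightarrow> v \<in> U"
      by metis
    \<comment> \<open>The extra 1 keeps the minimum meaningful for the empty family.\<close>
    have fin: "finite (insert 1 (\<delta> ` \<U>))"
      using assms by (simp add: clopen_family_def)
    have "Min (insert 1 (\<delta> ` \<U>)) > 0"
      using fin \<delta>(1) by (subst Min_gr_iff) auto
    moreover have "Min (insert 1 (\<delta> ` \<U>)) \<le> \<delta> U" if "U \<in> \<U>" for U
      using fin that by (intro Min_le) auto
    ultimately show ?thesis
      using \<delta>(2) by (meson less_le_trans)
  qed
  then obtain \<epsilon> where "\<epsilon> > 0"
    and \<epsilon>: "\<And>U u v. U \<in> \<U> \<Longrightarrow> u \<in> X \<Longrightarrow> v \<in> X \<Longrightarrow> d u v < \<epsilon> \<Longrightarrow> u \<in> U \<longleftrightarrow> v \<in> U"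
    by blast
  obtain \<delta> where "\<delta> > 0"
    and \<delta>: "\<And>u v g. u \<in> X \<Longrightarrow> v \<in> X \<Longrightarrow> g \<in> carrier G \<Longrightarrow> d u v < \<delta> \<Longrightarrow> d (\<phi> g u) (\<phi> g v) < \<epsilon>"
    using equicontinuous \<open>\<epsilon> > 0\<close> unfolding equicontinuous_action_def by meson
  have "mtotally_bounded X"
    using compact compactin_imp_mtotally_bounded unfolding compact_space_def by simp
  then obtain K where K: "finite K" "K \<subseteq> X" "X \<subseteq> (\<Union>k\<in>K. mball k \<delta>)"
    using \<open>\<delta> > 0\<close> unfolding mtotally_bounded_def by meson
  have "itinerary \<U> u \<in> itinerary \<U> ` K" if u: "u \<in> X" for u
  proof -
    obtain k where k: "k \<in> K" "d k u < \<delta>"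
      using u K by auto
    have "\<phi> h k \<in> U \<longleftrightarrow> \<phi> h u \<in> U" if "h \<in> carrier G" "U \<in> \<U>" for h U
    proof (rule \<epsilon>[OF that(2)])
      have kX: "k \<in> X"
        using k K(2) by blast
      show "\<phi> h k \<in> X" "\<phi> h u \<in> X"
        using that(1) kX u by (simp_all add: act_closed)
      show "d (\<phi> h k) (\<phi> h u) < \<epsilon>"
        using kX u that(1) k(2) by (rule \<delta>)
    qed
    then have "itinerary \<U> u = itinerary \<U> k"
      unfolding itinerary_def by blast
    then show ?thesis
      using k by blast
  qed
  then have "itinerary \<U> ` X \<subseteq> itinerary \<U> ` K"
    by blast
  then show ?thesis
    using K(1) finite_surj by blast
qed

lemma finite_rcosets_itinerary_kernel:
  assumes "clopen_family \<U>"
  shows "finite (rcosets (itinerary_kernel \<U>))"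
proof -
  let ?N = "itinerary_kernel \<U>"
  \<comment> \<open>\<open>?\<psi> g\<close> is the graph of the map that \<open>g\<close> induces
    on itineraries, a subset of a finite product.\<close>
  let ?\<psi> = "\<lambda>g. (\<lambda>u. (itinerary \<U> u, itinerary \<U> (\<phi> g u))) ` X"
  have sub: "subgroup ?N G"
    using itinerary_kernel_normal normal_imp_subgroup by blast
  have "?\<psi> ` carrier G \<subseteq> Pow (itinerary \<U> ` X \<times> itinerary \<U> ` X)"
    using act_closed by auto
  then have "finite (?\<psi> ` carrier G)"
    using finite_itineraries[OF assms] finite_subset by blast
  then have "finite ((\<lambda>g. ?N #> g) ` carrier G)"
  proof (rule finite_image_coarser)
    fix g h assume g: "g \<in> carrier G" and h: "h \<in> carrier G" and eq: "?\<psi> g = ?\<psi> h"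
    \<comment> \<open>Equal graphs supply only some \<open>w\<close> with the itinerary of
      \<open>v\<close>; \<open>itinerary_act\<close> replaces \<open>w\<close> by
      \<open>v\<close>.\<close>
    have *: "itinerary \<U> (\<phi> g v) = itinerary \<U> (\<phi> h v)" if v: "v \<in> X" for v
    proof -
      have "(itinerary \<U> v, itinerary \<U> (\<phi> g v)) \<in> ?\<psi> h"
        using v eq by blast
      then obtain w where w: "w \<in> X" "itinerary \<U> v = itinerary \<U> w"
        "itinerary \<U> (\<phi> g v) = itinerary \<U> (\<phi> h w)"
        by auto
      then show ?thesis
        using itinerary_act[OF h v w(1,2)] by simp
    qed
    have "itinerary \<U> (\<phi> (g \<otimes> inv h) u) = itinerary \<U> u" if u: "u \<in> X" for u
      using *[of "\<phi> (inv h) u"] u g h by (simp add: act_closed composition_rule act_inv')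
    then have "g \<otimes> inv h \<in> ?N"
      using g h by (simp add: itinerary_kernel_def)
    then have "g \<in> ?N #> h"
      by (rule subgroup.rcos_module_rev[OF sub is_group h g])
    then show "?N #> g = ?N #> h"
      using repr_independence[OF _ h sub] by simp
  qed
  then show ?thesis
    by (simp add: RCOSETS_def UNION_singleton_eq_range)
qed

subsection \<open>Orbit closures of normal subgroups of finite index\<close>

definition orbit_closure :: "'a set \<Rightarrow> 'b \<Rightarrow> 'b set" where
  "orbit_closure N u = mtopology closure_of ((\<lambda>n. \<phi> n u) ` N)"

lemma mem_orbit_closure:
  assumes "N \<subseteq> carrier G" "u \<in> X"
  shows "v \<in> orbit_closure N u \<longleftrightarrow> v \<in> X \<and> (\<forall>r>0. \<exists>n\<in>N. d v (\<phi> n u) < r)"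
proof -
  have "\<phi> n u \<in> X" if "n \<in> N" for n
    using that assms act_closed by blast
  then have "(\<exists>y\<in>(\<lambda>n. \<phi> n u) ` N. y \<in> mball v r) \<longleftrightarrow> v \<in> X \<and> (\<exists>n\<in>N. d v (\<phi> n u) < r)" for r
    by auto
  then show ?thesis
    unfolding orbit_closure_def metric_closure_of mem_Collect_eq by blast
qed

lemma orbit_closure_subset: "orbit_closure N u \<subseteq> X"
  unfolding orbit_closure_def using closure_of_subset_topspace by fastforce

lemma closedin_orbit_closure: "closedin mtopology (orbit_closure N u)"
  unfolding orbit_closure_def by simp

lemma orbit_closure_mono: "N \<subseteq> N' \<Longrightarrow> orbit_closure N u \<subseteq> orbit_closure N' u"
  unfolding orbit_closure_def by (intro closure_of_mono image_mono)

lemma orbit_closure_act: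
  assumes "subgroup N G" "u \<in> X" "n \<in> N"
  shows "\<phi> n u \<in> orbit_closure N u"
proof -
  have "N \<subseteq> carrier G"
    using assms(1) subgroup.subset by blast
  moreover from this have "\<phi> n u \<in> X"
    using assms act_closed by blast
  ultimately show ?thesis
    using assms mdist_zero mem_orbit_closure by metis
qed

lemma orbit_closure_refl:
  assumes "subgroup N G" "u \<in> X"
  shows "u \<in> orbit_closure N u"
  using orbit_closure_act[OF assms subgroup.one_closed[OF assms(1)]] assms(2) act_one by simp

text \<open>If \<open>\<phi> n u\<close> is close to \<open>v\<close>, applying \<open>inv n\<close>
  brings \<open>u\<close> close to \<open>\<phi> (inv n) v\<close>. Since \<open>\<delta>\<close> is
  fixed before \<open>n\<close> is known, the modulus must be uniform over the group.\<close>

lemma orbit_closure_sym: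
  assumes N: "subgroup N G" and u: "u \<in> X" and v: "v \<in> orbit_closure N u"
  shows "u \<in> orbit_closure N v"
proof -
  have NG: "N \<subseteq> carrier G"
    using N subgroup.subset by blast
  have vX: "v \<in> X"
    using v orbit_closure_subset by blast
  have "\<exists>n\<in>N. d u (\<phi> n v) < r" if "r > 0" for r
  proof -
    obtain \<delta> where "\<delta> > 0"
      and \<delta>: "\<And>p q g. p \<in> X \<Longrightarrow> q \<in> X \<Longrightarrow> g \<in> carrier G \<Longrightarrow> d p q < \<delta> \<Longrightarrow> d (\<phi> g p) (\<phi> g q) < r"
      using equicontinuous \<open>r > 0\<close> unfolding equicontinuous_action_def by meson
    obtain n where n: "n \<in> N" "d v (\<phi> n u) < \<delta>"
      using v \<open>\<delta> > 0\<close> mem_orbit_closure[OF NG u] by blast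
    have nG: "n \<in> carrier G"
      using n NG by blast
    have "d (\<phi> (inv n) v) (\<phi> (inv n) (\<phi> n u)) < r"
      using n nG vX u act_closed by (intro \<delta>) auto
    then have "d u (\<phi> (inv n) v) < r"
      using act_inv nG u commute by simp
    then show ?thesis
      using subgroup.m_inv_closed[OF N n(1)] by blast
  qed
  then show ?thesis
    using mem_orbit_closure[OF NG vX] u by blast
qed

text \<open>With \<open>\<phi> n u\<close> close to \<open>v\<close> and \<open>\<phi> m v\<close>
  close to \<open>w\<close>, the point \<open>\<phi> (m \<otimes> n) u\<close> is close to
  \<open>w\<close>.\<close>

lemma orbit_closure_trans:
  assumes N: "subgroup N G" and u: "u \<in> X"
    and v: "v \<in> orbit_closure N u" and w: "w \<in> orbit_closure N v"
  shows "w \<in> orbit_closure N u"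
proof -
  have NG: "N \<subseteq> carrier G"
    using N subgroup.subset by blast
  have vX: "v \<in> X" and wX: "w \<in> X"
    using v w orbit_closure_subset by blast+
  have "\<exists>n\<in>N. d w (\<phi> n u) < r" if "r > 0" for r
  proof -
    have "r / 2 > 0"
      using that by simp
    then obtain \<delta> where "\<delta> > 0"
      and \<delta>: "\<And>p q g. p \<in> X \<Longrightarrow> q \<in> X \<Longrightarrow> g \<in> carrier G \<Longrightarrow> d p q < \<delta> \<Longrightarrow> d (\<phi> g p) (\<phi> g q) < r / 2"
      using equicontinuous unfolding equicontinuous_action_def by meson
    obtain n where n: "n \<in> N" "d v (\<phi> n u) < \<delta>"
      using v \<open>\<delta> > 0\<close> mem_orbit_closure[OF NG u] by blast
    obtain m where m: "m \<in> N" "d w (\<phi> m v) < r / 2"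
      using w \<open>r / 2 > 0\<close> mem_orbit_closure[OF NG vX] by blast
    have G: "n \<in> carrier G" "m \<in> carrier G"
      using n m NG by auto
    have "d (\<phi> m v) (\<phi> m (\<phi> n u)) < r / 2"
      using n G vX u act_closed by (intro \<delta>) auto
    moreover have "d w (\<phi> m (\<phi> n u)) \<le> d w (\<phi> m v) + d (\<phi> m v) (\<phi> m (\<phi> n u))"
      using G vX wX u act_closed by (intro triangle) auto
    ultimately have "d w (\<phi> (m \<otimes> n) u) < r"
      using m G u by (simp add: composition_rule)
    then show ?thesis
      using subgroup.m_closed[OF N m(1) n(1)] by blast
  qed
  then show ?thesis
    using mem_orbit_closure[OF NG u] wX by blast
qed

lemma orbit_closure_eq:
  assumes "subgroup N G" "u \<in> X" "v \<in> orbit_closure N u"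
  shows "orbit_closure N v = orbit_closure N u"
proof -
  have "v \<in> X"
    using assms orbit_closure_subset by blast
  then show ?thesis
    using orbit_closure_trans[OF assms(1)] orbit_closure_sym[OF assms(1,2)] assms(2,3) by blast
qed

text \<open>Normality moves \<open>g\<close> past \<open>n\<close>: applying \<open>n\<close> and
  then \<open>g\<close> to \<open>u\<close> is applying the conjugate
  \<open>g \<otimes> n \<otimes> inv g\<close> to \<open>\<phi> g u\<close>.\<close>

lemma orbit_closure_image_subset:
  assumes N: "N \<lhd> G" and g: "g \<in> carrier G" and u: "u \<in> X"
  shows "\<phi> g ` orbit_closure N u \<subseteq> orbit_closure N (\<phi> g u)"
proof
  fix y assume "y \<in> \<phi> g ` orbit_closure N u"
  then obtain v where v: "v \<in> orbit_closure N u" and y: "y = \<phi> g v"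
    by blast
  have NG: "N \<subseteq> carrier G"
    using N normal_imp_subgroup subgroup.subset by blast
  have vX: "v \<in> X"
    using v orbit_closure_subset by blast
  have "\<exists>n\<in>N. d y (\<phi> n (\<phi> g u)) < r" if "r > 0" for r
  proof -
    obtain \<delta> where "\<delta> > 0"
      and \<delta>: "\<And>p q g. p \<in> X \<Longrightarrow> q \<in> X \<Longrightarrow> g \<in> carrier G \<Longrightarrow> d p q < \<delta> \<Longrightarrow> d (\<phi> g p) (\<phi> g q) < r"
      using equicontinuous \<open>r > 0\<close> unfolding equicontinuous_action_def by meson
    obtain n where n: "n \<in> N" "d v (\<phi> n u) < \<delta>"
      using v \<open>\<delta> > 0\<close> mem_orbit_closure[OF NG u] by blast
    have nG: "n \<in> carrier G"
      using n NG by blast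
    have "d y (\<phi> g (\<phi> n u)) < r"
      unfolding y using n nG g vX u act_closed by (intro \<delta>) auto
    moreover have "\<phi> g (\<phi> n u) = \<phi> (g \<otimes> n \<otimes> inv g) (\<phi> g u)"
      using g nG u by (simp add: composition_rule act_closed act_inv)
    ultimately show ?thesis
      using normal.inv_op_closed2[OF N g n(1)] by auto
  qed
  then show "y \<in> orbit_closure N (\<phi> g u)"
    using mem_orbit_closure[OF NG] act_closed g u vX y by blast
qed

lemma orbit_closure_image:
  assumes N: "N \<lhd> G" and g: "g \<in> carrier G" and u: "u \<in> X"
  shows "\<phi> g ` orbit_closure N u = orbit_closure N (\<phi> g u)"
proof
  show "orbit_closure N (\<phi> g u) \<subseteq> \<phi> g ` orbit_closure N u"
  proof
    fix y assume y: "y \<in> orbit_closure N (\<phi> g u)"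
    then have "\<phi> (inv g) y \<in> orbit_closure N (\<phi> (inv g) (\<phi> g u))"
      using orbit_closure_image_subset[OF N inv_closed[OF g] act_closed[OF g u]] by blast
    moreover have "y = \<phi> g (\<phi> (inv g) y)"
      using y orbit_closure_subset act_inv' g by (metis subsetD)
    ultimately show "y \<in> \<phi> g ` orbit_closure N u"
      using act_inv g u by (metis imageI)
  qed
qed (rule orbit_closure_image_subset[OF assms])

text \<open>The \<open>N\<close>-orbit of \<open>\<phi> g u\<close> is the image of \<open>u\<close>
  under the coset \<open>N #> g\<close>, so its closure depends on that coset alone.\<close>

lemma finite_orbit_closures:
  assumes N: "N \<lhd> G" and fin: "finite (rcosets N)" and u: "u \<in> X"
  shows "finite ((\<lambda>g. orbit_closure N (\<phi> g u)) ` carrier G)"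
proof -
  have NG: "N \<subseteq> carrier G"
    using N normal_imp_subgroup subgroup.subset by blast
  have "orbit_closure N (\<phi> g u) = mtopology closure_of ((\<lambda>k. \<phi> k u) ` (N #> g))"
    if g: "g \<in> carrier G" for g
  proof -
    have "(\<lambda>n. \<phi> n (\<phi> g u)) ` N = (\<lambda>k. \<phi> k u) ` (N #> g)"
      using g NG u by (force simp: r_coset_def composition_rule subset_iff)
    then show ?thesis
      by (simp add: orbit_closure_def)
  qed
  then have "(\<lambda>g. orbit_closure N (\<phi> g u)) ` carrier G
      \<subseteq> (\<lambda>A. mtopology closure_of ((\<lambda>k. \<phi> k u) ` A)) ` (rcosets N)"
    by (auto simp: RCOSETS_def)
  then show ?thesis
    using fin finite_surj by blast
qed

end

section \<open>Minimality: orbit closures form a finite clopen partition\<close>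

locale minimal_equicontinuous_system = equicontinuous_system +
  assumes minimal: "minimal_action G mtopology \<phi>"
begin

lemma orbit_meets_open:
  assumes "x \<in> X" "openin mtopology W" "y \<in> W"
  shows "\<exists>g\<in>carrier G. \<phi> g x \<in> W"
proof -
  have "mtopology closure_of (orbit G \<phi> x) = X"
    using minimal assms(1) unfolding minimal_action_def by simp
  moreover have "y \<in> X"
    using assms openin_subset by fastforce
  ultimately have "y \<in> mtopology closure_of (orbit G \<phi> x)"
    by simp
  then show ?thesis
    using assms(2,3) unfolding in_closure_of orbit_def by blast
qed

text \<open>The union is closed, being finite, and contains the dense orbit of
  \<open>x\<close>.\<close>

lemma Union_orbit_closures:
  assumes N: "N \<lhd> G" and fin: "finite (rcosets N)" and x: "x \<in> X"
  shows "(\<Union>g\<in>carrier G. orbit_closure N (\<phi> g x)) = X" (is "?L = X")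
proof
  show "?L \<subseteq> X"
    using orbit_closure_subset by blast
  have "closedin mtopology ?L"
    using finite_orbit_closures[OF assms] closedin_orbit_closure by (intro closedin_Union) auto
  moreover have "orbit G \<phi> x \<subseteq> ?L"
    using orbit_closure_refl[OF normal_imp_subgroup[OF N]] act_closed x
    unfolding orbit_def by blast
  ultimately have "mtopology closure_of (orbit G \<phi> x) \<subseteq> ?L"
    by (simp add: closure_of_minimal)
  then show "X \<subseteq> ?L"
    using minimal x unfolding minimal_action_def by simp
qed

lemma partition_orbit_closures:
  assumes N: "N \<lhd> G" and fin: "finite (rcosets N)" and x: "x \<in> X"
  shows "partition_on X ((\<lambda>g. orbit_closure N (\<phi> g x)) ` carrier G)"
proof (rule partition_onI)
  note sub = normal_imp_subgroup[OF N]
  show "\<Union> ((\<lambda>g. orbit_closure N (\<phi> g x)) ` carrier G) = X"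
    using Union_orbit_closures[OF assms] .
  show "{} \<notin> (\<lambda>g. orbit_closure N (\<phi> g x)) ` carrier G"
    using orbit_closure_refl[OF sub act_closed[OF _ x]] by force
next
  note sub = normal_imp_subgroup[OF N]
  fix p q assume "p \<in> (\<lambda>g. orbit_closure N (\<phi> g x)) ` carrier G"
    "q \<in> (\<lambda>g. orbit_closure N (\<phi> g x)) ` carrier G" and ne: "p \<noteq> q"
  then obtain g h where gh: "g \<in> carrier G" "h \<in> carrier G"
    "p = orbit_closure N (\<phi> g x)" "q = orbit_closure N (\<phi> h x)"
    by (elim imageE)
  show "disjnt p q"
  proof (rule ccontr)
    assume "\<not> disjnt p q"
    then obtain z where "z \<in> p" "z \<in> q"
      by (auto simp: disjnt_def)
    then have "p = orbit_closure N z" "q = orbit_closure N z"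
      unfolding gh(3,4) using orbit_closure_eq[OF sub act_closed[OF gh(1) x]]
        orbit_closure_eq[OF sub act_closed[OF gh(2) x]] by blast+
    then show False
      using ne by simp
  qed
qed

text \<open>The complement is the union of the finitely many other classes, all of them
  closed.\<close>

lemma openin_orbit_closure:
  assumes N: "N \<lhd> G" and fin: "finite (rcosets N)" and x: "x \<in> X"
  shows "openin mtopology (orbit_closure N x)"
proof -
  let ?P = "(\<lambda>g. orbit_closure N (\<phi> g x)) ` carrier G"
  have mem: "orbit_closure N x \<in> ?P"
    using act_one[OF x] one_closed by (metis imageI)
  have part: "partition_on X ?P"
    using partition_orbit_closures[OF assms] .
  have "X - orbit_closure N x = \<Union> (?P - {orbit_closure N x})"
  proof
    show "X - orbit_closure N x \<subseteq> \<Union> (?P - {orbit_closure N x})"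
      using partition_onD1[OF part] by blast
    have "A \<inter> orbit_closure N x = {}" if "A \<in> ?P - {orbit_closure N x}" for A
      using disjointD[OF partition_onD2[OF part] _ mem] that by blast
    then show "\<Union> (?P - {orbit_closure N x}) \<subseteq> X - orbit_closure N x"
      using orbit_closure_subset by blast
  qed
  moreover have "closedin mtopology (\<Union> (?P - {orbit_closure N x}))"
    using finite_orbit_closures[OF assms] closedin_orbit_closure by (intro closedin_Union) auto
  ultimately show ?thesis
    using orbit_closure_subset by (simp add: openin_closedin_eq)
qed

section \<open>Stabilizers of the clopen classes\<close>

text \<open>\<open>\<phi> g\<close> maps the class of \<open>x\<close> onto the class of
  \<open>\<phi> g x\<close>, and two classes agree as soon as they meet. The stabilizer becomes the
  set of return times of \<open>x\<close>.\<close>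

lemma stabilizer_orbit_closure:
  assumes N: "N \<lhd> G" and x: "x \<in> X"
  shows "stabilizer G (\<lambda>g A. \<phi> g ` A) (orbit_closure N x) = {g \<in> carrier G. \<phi> g x \<in> orbit_closure N x}"
proof -
  note sub = normal_imp_subgroup[OF N]
  have "\<phi> g ` orbit_closure N x = orbit_closure N x \<longleftrightarrow> \<phi> g x \<in> orbit_closure N x"
    if g: "g \<in> carrier G" for g
    using orbit_closure_image[OF N g x] orbit_closure_eq[OF sub x, of "\<phi> g x"]
      orbit_closure_refl[OF sub act_closed[OF g x]] by auto
  then show ?thesis
    unfolding stabilizer_def by auto
qed

lemma stabilizer_orbit_closure_subgroup:
  assumes N: "N \<lhd> G" and x: "x \<in> X"
  shows "subgroup {g \<in> carrier G. \<phi> g x \<in> orbit_closure N x} G" (is "subgroup ?H G")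
proof (rule subgroupI)
  note sub = normal_imp_subgroup[OF N]
  show "?H \<subseteq> carrier G" by blast
  show "?H \<noteq> {}"
    using one_closed act_one x orbit_closure_refl[OF sub x] by force
next
  note sub = normal_imp_subgroup[OF N]
  fix a assume "a \<in> ?H"
  then have a: "a \<in> carrier G" "\<phi> a x \<in> orbit_closure N x" by auto
  \<comment> \<open>The image is the class of \<open>\<phi> a x\<close>, which contains
    \<open>x\<close> by symmetry; undoing \<open>a\<close> then gives a return time.\<close>
  then have "x \<in> \<phi> a ` orbit_closure N x"
    using orbit_closure_image[OF N _ x] orbit_closure_sym[OF sub x] by simp
  then have "\<phi> (inv a) x \<in> orbit_closure N x"
    using act_inv a orbit_closure_subset by (metis imageE subsetD)
  then show "inv a \<in> ?H"
    using a by simp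
next
  note sub = normal_imp_subgroup[OF N]
  fix a b assume "a \<in> ?H" "b \<in> ?H"
  then have ab: "a \<in> carrier G" "\<phi> a x \<in> orbit_closure N x" "b \<in> carrier G" "\<phi> b x \<in> orbit_closure N x"
    by auto
  then have "\<phi> a (\<phi> b x) \<in> orbit_closure N (\<phi> a x)"
    using orbit_closure_image[OF N _ x] by blast
  then show "a \<otimes> b \<in> ?H"
    using ab x orbit_closure_eq[OF sub x] by (simp add: composition_rule)
qed

text \<open>The index of \<open>N\<close> is counted by right cosets, but \<open>group_chain\<close>
  asks for left ones. Normality identifies the two for \<open>N\<close>, and the coset of
  \<open>N\<close> determines that of \<open>H\<close>.\<close>

lemma finite_lcosets_supergroup:
  assumes N: "N \<lhd> G" and fin: "finite (rcosets N)" and H: "subgroup H G" and "N \<subseteq> H"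
  shows "finite (lcosets H)"
proof -
  have "finite ((\<lambda>g. N #> g) ` carrier G)"
    using fin by (simp add: RCOSETS_def UNION_singleton_eq_range)
  then have "finite ((\<lambda>g. g <# H) ` carrier G)"
  proof (rule finite_image_coarser)
    fix a b assume a: "a \<in> carrier G" and b: "b \<in> carrier G" and eq: "N #> a = N #> b"
    have "a \<in> N #> b"
      using eq rcos_self[OF a normal_imp_subgroup[OF N]] by simp
    also have "\<dots> = b <# N"
      using normal.coset_eq[OF N] b by blast
    also have "\<dots> \<subseteq> b <# H"
      using \<open>N \<subseteq> H\<close> unfolding l_coset_def by blast
    finally show "a <# H = b <# H"
      using l_repr_independence[OF _ b H] by simp
  qed
  then show ?thesis
    by (simp add: LCOSETS_def UNION_singleton_eq_range)
qed

lemma normal_form_orbit_closures: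
  assumes N: "\<And>i. N i \<lhd> G" and fin: "\<And>i. finite (rcosets (N i))" and x: "x \<in> X"
    and chain: "group_chain G (associated_chain G \<phi> (\<lambda>i. orbit_closure (N i) x))" (is "group_chain G ?H")
  shows "normal_form G ?H"
proof (rule normal_form_stepI[OF is_group chain])
  have H: "?H i = {g \<in> carrier G. \<phi> g x \<in> orbit_closure (N i) x}" for i
    unfolding associated_chain_def using stabilizer_orbit_closure[OF N x] .
  note sub = normal_imp_subgroup[OF N]
  fix i g assume "g \<in> ?H i"
  then have g: "g \<in> carrier G" "\<phi> g x \<in> orbit_closure (N i) x"
    by (auto simp: H)
  have "N i \<subseteq> ?H i"
    unfolding H using orbit_closure_act[OF sub x] subgroup.subset[OF sub] by blast
  then have core: "N i \<subseteq> normal_core G (?H i)"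
    by (rule normal_subset_normal_core[OF N])
  have "x \<in> orbit_closure (N i) (\<phi> g x)"
    using orbit_closure_sym[OF sub x] g by blast
  moreover have "openin mtopology (orbit_closure (N (Suc i)) x)" "x \<in> orbit_closure (N (Suc i)) x"
    using openin_orbit_closure[OF N fin x] orbit_closure_refl[OF sub x] by auto
  \<comment> \<open>Openness of the next class turns approximation of \<open>x\<close> into an
    actual hit; this \<open>n\<close> is the correcting factor and lies in the core.\<close>
  ultimately obtain n where n: "n \<in> N i" "\<phi> n (\<phi> g x) \<in> orbit_closure (N (Suc i)) x"
    unfolding orbit_closure_def[of "N i"] in_closure_of by blast
  then have "n \<otimes> g \<in> ?H (Suc i)"
    using g x subgroup.mem_carrier[OF sub n(1)] by (simp add: H composition_rule)
  then show "\<exists>n\<in>normal_core G (?H i). n \<otimes> g \<in> ?H (Suc i)"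
    using n(1) core by blast
qed

section \<open>Refinement of clopen families\<close>

text \<open>The entry of an itinerary at \<open>\<one>\<close> records membership in
  \<open>U\<close>. The kernel preserves it, so the \<open>N\<close>-orbit of
  \<open>\<phi> g x\<close> never leaves \<open>U\<close>, nor does its closure.\<close>

lemma orbit_closure_within_clopen:
  assumes N: "N = itinerary_kernel \<U>" and U: "U \<in> \<U>" "closedin mtopology U"
    and g: "g \<in> carrier G" and x: "x \<in> X" and "\<phi> g x \<in> U"
  shows "\<phi> g ` orbit_closure N x \<subseteq> U"
proof -
  have normal: "N \<lhd> G"
    unfolding N by (rule itinerary_kernel_normal)
  have "\<phi> n (\<phi> g x) \<in> U" if "n \<in> N" for n
  proof -
    have "(\<one>, U) \<in> itinerary \<U> (\<phi> g x)"
      using U g x \<open>\<phi> g x \<in> U\<close> by (simp add: itinerary_def act_one act_closed)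
    also have "itinerary \<U> (\<phi> g x) = itinerary \<U> (\<phi> n (\<phi> g x))"
      using that g x act_closed unfolding N itinerary_kernel_def by blast
    finally show ?thesis
      using that g x act_one act_closed unfolding N by (simp add: itinerary_def itinerary_kernel_def)
  qed
  then have "orbit_closure N (\<phi> g x) \<subseteq> U"
    unfolding orbit_closure_def using U(2) by (intro closure_of_minimal) auto
  then show ?thesis
    using orbit_closure_image[OF normal g x] by simp
qed

text \<open>A fine cover is added to \<open>\<U>\<close>. Its mesh lies below
  \<open>\<epsilon>\<close>, for small translates, and below the distance from \<open>x\<close> to
  another point \<open>y\<close> of the old class, which forces \<open>y\<close> out of the new
  one.\<close>

lemma refine_clopen_family:
  assumes td: "totally_disconnected_space mtopology" and perf: "perfect_space mtopology"
    and x: "x \<in> X" and \<U>: "clopen_family \<U>" and "\<epsilon> > 0"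
  obtains \<W> where "clopen_family \<W>" "\<U> \<subseteq> \<W>"
    "\<And>g u v. g \<in> carrier G \<Longrightarrow> u \<in> \<phi> g ` orbit_closure (itinerary_kernel \<W>) x \<Longrightarrow>
       v \<in> \<phi> g ` orbit_closure (itinerary_kernel \<W>) x \<Longrightarrow> d u v < \<epsilon>"
    "orbit_closure (itinerary_kernel \<W>) x \<subset> orbit_closure (itinerary_kernel \<U>) x"
proof -
  let ?V = "\<lambda>\<U>. orbit_closure (itinerary_kernel \<U>) x"
  have "openin mtopology (?V \<U>)"
    by (intro openin_orbit_closure itinerary_kernel_normal finite_rcosets_itinerary_kernel \<U> x)
  moreover have sub: "subgroup (itinerary_kernel \<W>) G" for \<W>
    using itinerary_kernel_normal normal_imp_subgroup by blast
  \<comment> \<open>Perfectness supplies \<open>y\<close>: the open class of \<open>x\<close> cannot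
    be the singleton of \<open>x\<close>.\<close>
  moreover have "x \<in> mtopology derived_set_of topspace mtopology"
    using perf x by (simp add: perfect_space_def)
  ultimately obtain y where y: "y \<in> ?V \<U>" "y \<noteq> x"
    using orbit_closure_refl[OF sub x] unfolding in_derived_set_of by blast
  have yX: "y \<in> X"
    using y orbit_closure_subset by blast
  have "min \<epsilon> (d x y) > 0"
    using \<open>\<epsilon> > 0\<close> y yX x by simp
  then obtain \<W> where \<W>: "finite \<W>" "\<And>U. U \<in> \<W> \<Longrightarrow> openin mtopology U \<and> closedin mtopology U"
    "\<Union>\<W> = X" "\<And>U u v. U \<in> \<W> \<Longrightarrow> u \<in> U \<Longrightarrow> v \<in> U \<Longrightarrow> d u v < min \<epsilon> (d x y)"
    using small_clopen_cover[OF compact td] by meson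
  have small: "d u v < min \<epsilon> (d x y)"
    if g: "g \<in> carrier G" and uv: "u \<in> \<phi> g ` ?V (\<U> \<union> \<W>)" "v \<in> \<phi> g ` ?V (\<U> \<union> \<W>)" for g u v
  proof -
    obtain U where U: "U \<in> \<W>" "\<phi> g x \<in> U"
      using act_closed[OF g x] \<W>(3) by blast
    then have "\<phi> g ` ?V (\<U> \<union> \<W>) \<subseteq> U"
      using g x \<W>(2) by (intro orbit_closure_within_clopen[OF refl]) auto
    then show ?thesis
      using uv \<W>(4)[OF U(1)] by blast
  qed
  have "y \<notin> ?V (\<U> \<union> \<W>)"
  proof
    assume "y \<in> ?V (\<U> \<union> \<W>)"
    then have "y \<in> \<phi> \<one> ` ?V (\<U> \<union> \<W>)" "x \<in> \<phi> \<one> ` ?V (\<U> \<union> \<W>)"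
      using orbit_closure_refl[OF sub x] act_one x yX by (metis imageI)+
    then show False
      using small[of \<one> x y] by simp
  qed
  moreover have "?V (\<U> \<union> \<W>) \<subseteq> ?V \<U>"
    by (intro orbit_closure_mono itinerary_kernel_mono) auto
  ultimately have "?V (\<U> \<union> \<W>) \<subset> ?V \<U>"
    using y by blast
  then show ?thesis
    using small \<W> \<U> by (intro that[of "\<U> \<union> \<W>"]) (auto simp: clopen_family_def)
qed

section \<open>The group chain and its partitions\<close>

lemma group_chain_orbit_closures:
  assumes N: "\<And>i. N i \<lhd> G" and fin: "\<And>i. finite (rcosets (N i))" and "N 0 = carrier G"
    and x: "x \<in> X" and dec: "\<And>i. orbit_closure (N (Suc i)) x \<subset> orbit_closure (N i) x"
  shows "group_chain G (associated_chain G \<phi> (\<lambda>i. orbit_closure (N i) x))" (is "group_chain G ?H")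
proof -
  note sub = normal_imp_subgroup[OF N]
  have H: "?H i = {g \<in> carrier G. \<phi> g x \<in> orbit_closure (N i) x}" for i
    unfolding associated_chain_def using stabilizer_orbit_closure[OF N x] .
  have NH: "N i \<subseteq> ?H i" for i
    unfolding H using orbit_closure_act[OF sub x] subgroup.subset[OF sub] by blast
  have subH: "subgroup (?H i) G" for i
    unfolding H using stabilizer_orbit_closure_subgroup[OF N x] .
  have "?H 0 = carrier G"
    using NH[of 0] subgroup.subset[OF subH] \<open>N 0 = carrier G\<close> by blast
  moreover have "finite (lcosets (?H i))" for i
    using finite_lcosets_supergroup[OF N fin subH NH] .
  moreover have "?H (Suc i) \<subset> ?H i" for i
  proof -
    \<comment> \<open>Strict descent of the classes must be transferred to the stabilizers: the
      difference of two successive classes is open and nonempty, so the orbit of \<open>x\<close>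
      meets it, at a group element lost from level \<open>i\<close> to the next.\<close>
    obtain y where "y \<in> orbit_closure (N i) x - orbit_closure (N (Suc i)) x"
      using dec by blast
    moreover have "openin mtopology (orbit_closure (N i) x - orbit_closure (N (Suc i)) x)"
      by (intro openin_diff openin_orbit_closure N fin x closedin_orbit_closure)
    ultimately obtain g where "g \<in> carrier G" "\<phi> g x \<in> orbit_closure (N i) x - orbit_closure (N (Suc i)) x"
      using orbit_meets_open[OF x] by blast
    then show ?thesis
      using dec[of i] unfolding H by blast
  qed
  ultimately show ?thesis
    using subH unfolding group_chain_def by blast
qed

text \<open>\<open>small\<close> bounds distances at level \<open>Suc i\<close> by half of what the
  diameter condition asks for, because a supremum of strictly smaller distances may attain the
  bound.\<close>

lemma chain_of_partitions_orbit_closures: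
  assumes N: "\<And>i. N i \<lhd> G" and fin: "\<And>i. finite (rcosets (N i))" and N0: "N 0 = carrier G"
    and x: "x \<in> X" and dec: "\<And>i. orbit_closure (N (Suc i)) x \<subset> orbit_closure (N i) x"
    and small: "\<And>i g u v. g \<in> carrier G \<Longrightarrow> u \<in> \<phi> g ` orbit_closure (N (Suc i)) x \<Longrightarrow>
       v \<in> \<phi> g ` orbit_closure (N (Suc i)) x \<Longrightarrow> d u v < 1 / 2 ^ Suc (Suc i)"
  shows "chain_of_partitions G X d \<phi> x (\<lambda>i. orbit_closure (N i) x)
           (\<lambda>i. {\<phi> g ` orbit_closure (N i) x |g. g \<in> carrier G})" (is "chain_of_partitions G X d \<phi> x ?V ?P")
proof -
  note sub = normal_imp_subgroup[OF N]
  have xV: "x \<in> ?V i" for i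
    using orbit_closure_refl[OF sub x] .
  have P: "?P i = (\<lambda>g. orbit_closure (N i) (\<phi> g x)) ` carrier G" for i
    by (simp add: setcompr_eq_image orbit_closure_image[OF N _ x] cong: image_cong)
  have base: "?V 0 = X"
  proof
    show "X \<subseteq> ?V 0"
      using minimal x unfolding N0 orbit_closure_def minimal_action_def orbit_def
      by (simp add: setcompr_eq_image)
  qed (rule orbit_closure_subset)
  have inter: "(\<Inter>i. ?V i) = {x}"
  proof -
    have "z = x" if z: "\<And>i. z \<in> ?V i" for z
    proof (rule ccontr)
      assume "z \<noteq> x"
      have zX: "z \<in> X"
        using z orbit_closure_subset by blast
      then have "d x z > 0"
        using \<open>z \<noteq> x\<close> x by simp
      then obtain k where k: "(1 / 2) ^ k < d x z"
        using real_arch_pow_inv[of "d x z" "1/2"] by auto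
      \<comment> \<open>The class itself is written as its translate by \<open>\<one>\<close> to fit
        \<open>small\<close>.\<close>
      have "x \<in> \<phi> \<one> ` ?V (Suc k)" "z \<in> \<phi> \<one> ` ?V (Suc k)"
        using act_one x zX xV z by (metis imageI)+
      then have "d x z < 1 / 2 ^ Suc (Suc k)"
        by (intro small) auto
      also have "\<dots> \<le> (1 / 2) ^ k"
        by (simp add: power_divide field_simps)
      finally show False
        using k by simp
    qed
    then show ?thesis
      using xV by blast
  qed
  have diam: "mdiameter d (\<phi> g ` ?V i) < 1 / 2 ^ i" if "i \<ge> 1" and g: "g \<in> carrier G" for i g
  proof -
    obtain j where j: "i = Suc j"
      using \<open>i \<ge> 1\<close> by (cases i) auto
    let ?S = "\<phi> g ` ?V i"
    have ne: "?S \<noteq> {}"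
      using xV by blast
    have "case p of (u, v) \<Rightarrow> d u v \<le> 1 / 2 ^ Suc (Suc j)" if "p \<in> ?S \<times> ?S" for p
      using small[OF g, of "fst p" j "snd p"] that unfolding j by (cases p) simp
    then have "(SUP (u, v)\<in>?S \<times> ?S. d u v) \<le> 1 / 2 ^ Suc (Suc j)"
      using ne by (intro cSUP_least) fastforce+
    then have "mdiameter d ?S \<le> 1 / 2 ^ Suc (Suc j)"
      using ne by (simp only: mdiameter_def if_False)
    also have "\<dots> < 1 / 2 ^ i"
      by (simp add: j field_simps)
    finally show ?thesis .
  qed
  have "finite (?P i) \<and> partition_on X (?P i)" for i
    unfolding P using finite_orbit_closures[OF N fin x] partition_orbit_closures[OF N fin x] by blast
  \<comment> \<open>The trivial equation matches the conjunct of \<open>chain_of_partitions\<close>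
    that prescribes the form of \<open>P i\<close>.\<close>
  then have part: "\<forall>i. ?P i = ?P i \<and> finite (?P i) \<and> partition_on X (?P i)"
    by simp
  have clopen: "\<forall>i. openin mtopology (?V i) \<and> closedin mtopology (?V i)"
    using openin_orbit_closure[OF N fin x] closedin_orbit_closure by auto
  have decr: "\<forall>i. ?V (Suc i) \<subseteq> ?V i"
    using dec by auto
  show ?thesis
    unfolding chain_of_partitions_def
    by (intro conjI base decr clopen inter part) (use diam in simp)
qed

end

section \<open>Recursive choice of the families\<close>

theorem proposition5p7:
  fixes G :: "('a, 'm) monoid_scheme" and X :: "'b set" and d :: "'b \<Rightarrow> 'b \<Rightarrow> real"
    and \<phi> :: "'a \<Rightarrow> 'b \<Rightarrow> 'b" and x :: 'b
  assumes "finitely_generated_group G" and "infinite (carrier G)"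
    and "Metric_space X d" and "cantor_space (Metric_space.mtopology X d)"
    and "action_by_homeomorphisms G (Metric_space.mtopology X d) \<phi>"
    and "minimal_action G (Metric_space.mtopology X d) \<phi>"
    and "equicontinuous_action G X d \<phi>"
    and "x \<in> X"
  shows "\<exists>V P. chain_of_partitions G X d \<phi> x V P \<and>
               group_chain G (associated_chain G \<phi> V) \<and>
               normal_form G (associated_chain G \<phi> V)"
proof -
  interpret Metric_space X d by fact
  interpret group_action G X \<phi>
    using assms(5) by (simp add: action_by_homeomorphisms_def)
  interpret minimal_equicontinuous_system G X \<phi> d
    using assms(4,6,7) by unfold_locales (simp_all add: cantor_space_def)
  have cantor: "totally_disconnected_space mtopology" "perfect_space mtopology"
    using assms(4) unfolding cantor_space_def by auto
  let ?V = "\<lambda>\<U>. orbit_closure (itinerary_kernel \<U>) x"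
  let ?small = "\<lambda>n \<U>. \<forall>g\<in>carrier G. \<forall>u \<in> \<phi> g ` ?V \<U>. \<forall>v \<in> \<phi> g ` ?V \<U>. d u v < 1 / 2 ^ Suc n"
  \<comment> \<open>Dependent choice along strictly shrinking classes. Level 0 is pinned to the
    empty family, which makes the first kernel all of \<open>G\<close>; smallness is imposed only
    from level 1 on.\<close>
  have "\<exists>\<U>. \<forall>n. (clopen_family (\<U> n) \<and> (if n = 0 then \<U> n = {} else ?small n (\<U> n)))
      \<and> ?V (\<U> (Suc n)) \<subset> ?V (\<U> n)"
  proof (rule dependent_nat_choice)
    fix \<U> n assume "clopen_family \<U> \<and> (if n = 0 then \<U> = {} else ?small n \<U>)"
    then have "clopen_family \<U>" by blast
    moreover have "1 / 2 ^ Suc (Suc n) > (0::real)" by simp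
    ultimately obtain \<W> where "clopen_family \<W>" "?small (Suc n) \<W>" "?V \<W> \<subset> ?V \<U>"
      using refine_clopen_family[OF cantor \<open>x \<in> X\<close>] by metis
    then show "\<exists>\<W>. (clopen_family \<W> \<and> (if Suc n = 0 then \<W> = {} else ?small (Suc n) \<W>))
        \<and> ?V \<W> \<subset> ?V \<U>"
      by auto
  qed (simp add: clopen_family_def)
  then obtain \<U> where \<U>: "\<And>n. clopen_family (\<U> n)" "\<U> 0 = {}" "\<And>n. ?small (Suc n) (\<U> (Suc n))"
    "\<And>n. ?V (\<U> (Suc n)) \<subset> ?V (\<U> n)"
    by (metis nat.distinct(1))
  define N where "N n = itinerary_kernel (\<U> n)" for n
  have N: "N n \<lhd> G" "finite (rcosets\<^bsub>G\<^esub> (N n))" for n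
    unfolding N_def using itinerary_kernel_normal finite_rcosets_itinerary_kernel \<U>(1) by auto
  have N0: "N 0 = carrier G"
    by (simp add: N_def \<U>(2) itinerary_kernel_empty)
  have dec: "orbit_closure (N (Suc i)) x \<subset> orbit_closure (N i) x" for i
    using \<U>(4) by (simp add: N_def)
  have chain: "group_chain G (associated_chain G \<phi> (\<lambda>i. orbit_closure (N i) x))"
    using group_chain_orbit_closures[of N, OF N N0 \<open>x \<in> X\<close> dec] .
  moreover have "normal_form G (associated_chain G \<phi> (\<lambda>i. orbit_closure (N i) x))"
    using normal_form_orbit_closures[of N, OF N \<open>x \<in> X\<close> chain] .
  moreover have "chain_of_partitions G X d \<phi> x (\<lambda>i. orbit_closure (N i) x)
      (\<lambda>i. {\<phi> g ` orbit_closure (N i) x |g. g \<in> carrier G})"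
    using \<U>(3) by (intro chain_of_partitions_orbit_closures N N0 \<open>x \<in> X\<close> dec) (auto simp: N_def)
  ultimately show ?thesis by blast
qed

end
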